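(* Let $m\ge2$ and let $G$ be a connected $m$-uniform hypergraph with cut vertices. If $G$ has $s\ge 2$ blocks $G_1,\dots,G_s$, then $s(G)=\prod_{i=1}^s s(G_i)$.
   Context: An $m$-uniform hypergraph $G=(V,E)$ has a finite vertex set $V=\{v_1,\dots,v_n\}$ and an edge set $E$ of $m$-element subsets of $V$; it is connected if any two vertices are joined by a walk $v_0e_1v_1\dots e_tv_t$ ($v_{i-1}\ne v_i$, $\{v_{i-1},v_i\}\subseteq e_i$). For vertex-disjoint nontrivial (more than one vertex) connected hypergraphs $H_1,H_2$ and vertices $w_1\in V(H_1)$, $w_2\in V(H_2)$, the coalescence $H_1(u)\odot H_2(u)$ is obtained by identifying $w_1$ and $w_2$ into a new vertex $u$; a vertex $u$ of $G$ is a cut vertex if $G$ is such a coalescence at $u$. A block of $G$ is an edge-maximal connected sub-hypergraph of $G$ without cut vertices. The adjacency tensor $\mathcal{A}(G)=(a_{i_1\dots i_m})$ is the order-$m$, dimension-$n$ tensor with $a_{i_1\dots i_m}=\frac{1}{(m-1)!}$ if $\{v_{i_1},\dots,v_{i_m}\}\in E$ and $0$ otherwise. For an order-$m$, dimension-$n$ tensor $\mathcal{A}$, $s(\mathcal{A})$ is the cardinality of the set of invertible complex diagonal matrices $D=\mathrm{diag}(d_1,\dots,d_n)$ with $d_1=1$ such that $d_{i_1}^{-(m-1)}a_{i_1\dots i_m}d_{i_2}\cdots d_{i_m}=a_{i_1\dots i_m}$ for all $i_1,\dots,i_m\in[n]$. The stabilizing index of a hypergraph $H$ is $s(H):=s(\mathcal{A}(H))$.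 *)

theory Defs
  imports Complex_Main "Jordan_Normal_Form.Matrix"
begin

datatype 'a hypergraph = Hypergraph (verts: "'a set") (edges: "'a set set")

definition uniform_hypergraph :: "nat \<Rightarrow> 'a hypergraph \<Rightarrow> bool" where
  "uniform_hypergraph m H \<longleftrightarrow> finite (verts H) \<and> verts H \<noteq> {} \<and>
     (\<forall>e\<in>edges H. e \<subseteq> verts H \<and> card e = m)"

(* The walk v0 e1 v1 ... et vt is given by xs = [v0, ..., vt] and es = [e1, ..., et]. *)
definition hwalk :: "'a hypergraph \<Rightarrow> 'a list \<Rightarrow> 'a set list \<Rightarrow> bool" where
  "hwalk H xs es \<longleftrightarrow> length xs = Suc (length es) \<and> set xs \<subseteq> verts H \<and> set es \<subseteq> edges H \<and>
     (\<forall>i<length es. xs ! i \<noteq> xs ! Suc i \<and> {xs ! i, xs ! Suc i} \<subseteq> es ! i)"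

definition hconnected :: "'a hypergraph \<Rightarrow> bool" where
  "hconnected H \<longleftrightarrow>
     (\<forall>x\<in>verts H. \<forall>y\<in>verts H. \<exists>xs es. hwalk H xs es \<and> hd xs = x \<and> last xs = y)"

definition nontrivial :: "'a hypergraph \<Rightarrow> bool" where
  "nontrivial H \<longleftrightarrow> card (verts H) > 1"

definition hg_iso :: "('a \<Rightarrow> 'b) \<Rightarrow> 'a hypergraph \<Rightarrow> 'b hypergraph \<Rightarrow> bool" where
  "hg_iso f G H \<longleftrightarrow> bij_betw f (verts G) (verts H) \<and> edges H = (\<lambda>e. f ` e) ` edges G"

(* In the coalescence, None is the new vertex into which w1 and w2 are identified;
   every other vertex x becomes Some x. *)
definition identify :: "'a \<Rightarrow> 'a \<Rightarrow> 'a \<Rightarrow> 'a option" where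
  "identify w1 w2 x = (if x = w1 \<or> x = w2 then None else Some x)"

definition coalescence ::
    "'a hypergraph \<Rightarrow> 'a \<Rightarrow> 'a hypergraph \<Rightarrow> 'a \<Rightarrow> 'a option hypergraph" where
  "coalescence H1 w1 H2 w2 =
     Hypergraph (identify w1 w2 ` (verts H1 \<union> verts H2))
                ((\<lambda>e. identify w1 w2 ` e) ` (edges H1 \<union> edges H2))"

(* The type 'a + 'a always has room for two vertex-disjoint hypergraphs of which G is,
   up to isomorphism, the coalescence; 'a itself need not have, since the two have one
   vertex more in total than G. *)
definition cut_vertex :: "nat \<Rightarrow> 'a hypergraph \<Rightarrow> 'a \<Rightarrow> bool" where
  "cut_vertex m G u \<longleftrightarrow> u \<in> verts G \<and>
     (\<exists>(H1 :: ('a + 'a) hypergraph) (H2 :: ('a + 'a) hypergraph) w1 w2 f.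
        uniform_hypergraph m H1 \<and> hconnected H1 \<and> nontrivial H1 \<and>
        uniform_hypergraph m H2 \<and> hconnected H2 \<and> nontrivial H2 \<and>
        verts H1 \<inter> verts H2 = {} \<and> w1 \<in> verts H1 \<and> w2 \<in> verts H2 \<and>
        hg_iso f G (coalescence H1 w1 H2 w2) \<and> f u = None)"

definition sub_hypergraph :: "nat \<Rightarrow> 'a hypergraph \<Rightarrow> 'a hypergraph \<Rightarrow> bool" where
  "sub_hypergraph m H G \<longleftrightarrow>
     uniform_hypergraph m H \<and> verts H \<subseteq> verts G \<and> edges H \<subseteq> edges G"

definition conn_sub_without_cut :: "nat \<Rightarrow> 'a hypergraph \<Rightarrow> 'a hypergraph \<Rightarrow> bool" where
  "conn_sub_without_cut m H G \<longleftrightarrow>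
     sub_hypergraph m H G \<and> hconnected H \<and> (\<nexists>u. cut_vertex m H u)"

definition block :: "nat \<Rightarrow> 'a hypergraph \<Rightarrow> 'a hypergraph \<Rightarrow> bool" where
  "block m B G \<longleftrightarrow> conn_sub_without_cut m B G \<and>
     (\<forall>H. conn_sub_without_cut m H G \<longrightarrow> \<not> edges B \<subset> edges H)"

(* A tensor of order m and dimension n maps an index list of length m with entries below n
   to its entry; indices start at 0. *)
type_synonym tensor = "nat list \<Rightarrow> complex"

definition stabilizer :: "nat \<Rightarrow> nat \<Rightarrow> tensor \<Rightarrow> complex mat set" where
  "stabilizer m n A =
     {D \<in> carrier_mat n n. diagonal_mat D \<and> invertible_mat D \<and> D $$ (0, 0) = 1 \<and>
        (\<forall>idx. length idx = m \<and> set idx \<subseteq> {..<n} \<longrightarrow>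
           inverse (D $$ (idx ! 0, idx ! 0)) ^ (m - 1) * A idx *
             (\<Prod>k=1..<m. D $$ (idx ! k, idx ! k)) = A idx)}"

definition tensor_stab_index :: "nat \<Rightarrow> nat \<Rightarrow> tensor \<Rightarrow> nat" where
  "tensor_stab_index m n A = card (stabilizer m n A)"

definition vertex_enum :: "'a list \<Rightarrow> 'a hypergraph \<Rightarrow> bool" where
  "vertex_enum vs H \<longleftrightarrow> distinct vs \<and> set vs = verts H"

definition adjacency_tensor :: "nat \<Rightarrow> 'a hypergraph \<Rightarrow> 'a list \<Rightarrow> tensor" where
  "adjacency_tensor m H vs idx =
     (if (\<lambda>i. vs ! i) ` set idx \<in> edges H then 1 / fact (m - 1) else 0)"

definition stab_index :: "nat \<Rightarrow> 'a hypergraph \<Rightarrow> 'a list \<Rightarrow> nat" where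
  "stab_index m H vs = tensor_stab_index m (length vs) (adjacency_tensor m H vs)"

end

theory Submission
  imports Defs "HOL-Library.FuncSet"
begin

text \<open>
  A diagonal matrix stabilizes the adjacency tensor iff its diagonal \<open>d\<close>, read as a function on the
  vertices, satisfies \<open>d x ^ m = (\<Prod>y\<in>e. d y)\<close> for every edge \<open>e\<close> and every \<open>x \<in> e\<close>.
  These equations are invariant under scaling \<open>d\<close>, so the solutions may be normalized at any vertex.
  If \<open>G\<close> is the union of \<open>G1\<close> and \<open>G2\<close> meeting only in a cut vertex \<open>u\<close>, then solutions on \<open>G\<close>
  normalized at \<open>u\<close> are exactly pairs of such solutions on \<open>G1\<close> and \<open>G2\<close>, while the blocks of \<open>G\<close>
  are the blocks of \<open>G1\<close> together with those of \<open>G2\<close>, because a connected sub-hypergraph with edges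
  on both sides has \<open>u\<close> as a cut vertex. Induction on the number of vertices finishes the proof.
\<close>

section \<open>Connectivity\<close>

text \<open>When edges consist of vertices, these sets are the unions of connected components.
  Arguments with them replace the handling of walks in all later connectivity proofs.\<close>

definition closed_in :: "'a hypergraph \<Rightarrow> 'a set \<Rightarrow> bool" where
  "closed_in H S \<longleftrightarrow> S \<subseteq> verts H \<and> (\<forall>e\<in>edges H. e \<inter> S \<noteq> {} \<longrightarrow> e \<subseteq> S)"

lemma hwalk_last_in_closed:
  assumes cl: "closed_in H S" and w: "hwalk H xs es" and x: "hd xs \<in> S"
  shows "last xs \<in> S"
proof -
  have len: "length xs = Suc (length es)"
    using w by (simp add: hwalk_def)
  then have ne: "xs \<noteq> []" by auto
  have "xs ! i \<in> S" if "i \<le> length es" for i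
    using that
  proof (induction i)
    case 0
    then show ?case using x ne by (simp add: hd_conv_nth)
  next
    case (Suc i)
    then have "xs ! i \<in> S" "{xs ! i, xs ! Suc i} \<subseteq> es ! i" "es ! i \<in> edges H"
      using w by (auto simp: hwalk_def)
    then show ?case using cl unfolding closed_in_def by blast
  qed
  then show ?thesis using len ne by (simp add: last_conv_nth)
qed

lemma hwalk_snoc:
  assumes w: "hwalk H xs es" and e: "e \<in> edges H" "e \<subseteq> verts H"
    and z: "last xs \<in> e" "z \<in> e" "last xs \<noteq> z"
  shows "hwalk H (xs @ [z]) (es @ [e])"
proof -
  have len: "length xs = Suc (length es)"
    using w by (simp add: hwalk_def)
  then have "last xs = xs ! length es"
    by (metis diff_Suc_1 last_conv_nth list.size(3) nat.distinct(1))
  then show ?thesis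
    using assms len unfolding hwalk_def by (auto simp: nth_append less_Suc_eq)
qed

text \<open>A walk never leaves a closed set that it starts in. Conversely, the set of vertices
  reachable from a fixed vertex \<open>x\<close> is closed, and the walk of length zero puts
  \<open>x\<close> into it.\<close>

lemma hconnected_iff_closed:
  assumes "\<And>e. e \<in> edges H \<Longrightarrow> e \<subseteq> verts H"
  shows "hconnected H \<longleftrightarrow> (\<forall>S. closed_in H S \<longrightarrow> S = {} \<or> S = verts H)"
proof (intro iffI allI impI)
  fix S assume con: "hconnected H" and cl: "closed_in H S"
  show "S = {} \<or> S = verts H"
  proof (cases "S = {}")
    case False
    then obtain x where x: "x \<in> S" by blast
    have "y \<in> S" if y: "y \<in> verts H" for y
    proof -
      have "x \<in> verts H" using x cl by (auto simp: closed_in_def)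
      then obtain xs es where "hwalk H xs es" "hd xs = x" "last xs = y"
        using con y unfolding hconnected_def by blast
      then show ?thesis using hwalk_last_in_closed[OF cl, of xs es] x by simp
    qed
    then show ?thesis using cl by (auto simp: closed_in_def)
  qed simp
next
  assume *: "\<forall>S. closed_in H S \<longrightarrow> S = {} \<or> S = verts H"
  show "hconnected H"
    unfolding hconnected_def
  proof (intro ballI)
    fix x y assume x: "x \<in> verts H" and y: "y \<in> verts H"
    define S where "S = {y. \<exists>xs es. hwalk H xs es \<and> hd xs = x \<and> last xs = y}"
    have "z \<in> S" if e: "e \<in> edges H" "y \<in> e" "y \<in> S" "z \<in> e" for e y z
    \<comment> \<open>Consecutive vertices of a walk must differ, so a walk ending in
      \<open>y\<close> is extended through \<open>e\<close> only if \<open>z\<close> is a different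
      vertex.\<close>
    proof (cases "y = z")
      case True
      then show ?thesis using that by simp
    next
      case False
      obtain xs es where w: "hwalk H xs es" "hd xs = x" "last xs = y"
        using e(3) unfolding S_def by blast
      then have "hwalk H (xs @ [z]) (es @ [e])"
        using hwalk_snoc[OF w(1) e(1) assms[OF e(1)]] e False by simp
      moreover have "xs \<noteq> []" using w(1) by (auto simp: hwalk_def)
      then have "hd (xs @ [z]) = x" "last (xs @ [z]) = z" using w(2) by auto
      ultimately show ?thesis unfolding S_def by blast
    qed
    moreover have "S \<subseteq> verts H"
    proof
      fix y assume "y \<in> S"
      then obtain xs es where w: "hwalk H xs es" "last xs = y"
        unfolding S_def by blast
      then have "xs \<noteq> []" "set xs \<subseteq> verts H" by (auto simp: hwalk_def)
      then show "y \<in> verts H" using w last_in_set by blast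
    qed
    ultimately have "closed_in H S" unfolding closed_in_def by blast
    moreover have "x \<in> S"
    proof -
      have "hwalk H [x] []" using x by (simp add: hwalk_def)
      then show ?thesis unfolding S_def by fastforce
    qed
    ultimately have "y \<in> S" using * y by blast
    then show "\<exists>xs es. hwalk H xs es \<and> hd xs = x \<and> last xs = y"
      by (simp add: S_def)
  qed
qed

lemma uniform_edge:
  assumes "uniform_hypergraph m H" "e \<in> edges H"
  shows "e \<subseteq> verts H" "card e = m"
  using assms by (auto simp: uniform_hypergraph_def)

lemma hconnected_closedD:
  assumes "uniform_hypergraph m H" "hconnected H" "closed_in H S" "S \<noteq> {}"
  shows "S = verts H"
  using assms hconnected_iff_closed[OF uniform_edge(1)[OF assms(1)]] by blast

lemma hconnected_closedI:
  assumes "uniform_hypergraph m H" "\<And>S. closed_in H S \<Longrightarrow> S \<noteq> {} \<Longrightarrow> S = verts H"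
  shows "hconnected H"
  using assms hconnected_iff_closed[OF uniform_edge(1)[OF assms(1)]] by blast

text \<open>The vertices covered by edges form a nonempty closed set, so connectivity excludes
  isolated vertices. Hence a connected hypergraph with an edge is determined by its edge set, which
  links the edge-maximality in \<open>block\<close> to equality of hypergraphs.\<close>

lemma verts_eq_Union_edges:
  assumes u: "uniform_hypergraph m H" and c: "hconnected H" and "edges H \<noteq> {}" "m \<ge> 1"
  shows "verts H = \<Union> (edges H)"
proof -
  obtain e where "e \<in> edges H" "e \<noteq> {}"
    using assms uniform_edge(2)[OF u] by fastforce
  then have "\<Union> (edges H) \<noteq> {}" by blast
  moreover have "closed_in H (\<Union> (edges H))"
    using uniform_edge(1)[OF u] by (auto simp: closed_in_def)
  ultimately show ?thesis using hconnected_closedD[OF u c] by metis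
qed

text \<open>Without edges every singleton is closed, so a connected hypergraph would have only one
  vertex.\<close>

lemma hconnected_nontrivial_edges:
  assumes u: "uniform_hypergraph m H" and c: "hconnected H" and "nontrivial H"
  shows "edges H \<noteq> {}"
proof
  assume e: "edges H = {}"
  obtain x where "x \<in> verts H" using u by (auto simp: uniform_hypergraph_def)
  then have "closed_in H {x}" using e by (simp add: closed_in_def)
  then have "{x} = verts H" using hconnected_closedD[OF u c] by blast
  then have "card (verts H) = 1" by (metis card_1_singleton_iff One_nat_def)
  then show False using assms by (simp add: nontrivial_def)
qed

lemma edges_nontrivial:
  assumes u: "uniform_hypergraph m H" and "edges H \<noteq> {}" "m \<ge> 2"
  shows "nontrivial H"
proof -
  obtain e where e: "e \<in> edges H" using assms by blast
  have "card e \<le> card (verts H)"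
    using uniform_edge(1)[OF u e] u by (simp add: card_mono uniform_hypergraph_def)
  then show ?thesis using uniform_edge(2)[OF u e] assms by (simp add: nontrivial_def)
qed

section \<open>Images of hypergraphs under injective maps\<close>

definition hg_image :: "('a \<Rightarrow> 'b) \<Rightarrow> 'a hypergraph \<Rightarrow> 'b hypergraph" where
  "hg_image f H = Hypergraph (f ` verts H) ((\<lambda>e. f ` e) ` edges H)"

lemma hg_image_sel [simp]:
  "verts (hg_image f H) = f ` verts H" "edges (hg_image f H) = (\<lambda>e. f ` e) ` edges H"
  by (simp_all add: hg_image_def)

lemma uniform_hg_image:
  assumes u: "uniform_hypergraph m H" and inj: "inj_on f (verts H)"
  shows "uniform_hypergraph m (hg_image f H)"
proof -
  have "card (f ` e) = m" if "e \<in> edges H" for e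
    using uniform_edge[OF u that] inj by (metis card_image inj_on_subset)
  then show ?thesis using u unfolding uniform_hypergraph_def by auto
qed

lemma nontrivial_hg_image:
  assumes "inj_on f (verts H)"
  shows "nontrivial (hg_image f H) \<longleftrightarrow> nontrivial H"
  using assms by (simp add: nontrivial_def card_image)

text \<open>The preimage of a closed set of the image is closed in \<open>H\<close>, so it is
  everything.\<close>

lemma hconnected_hg_image:
  assumes u: "uniform_hypergraph m H" and inj: "inj_on f (verts H)" and c: "hconnected H"
  shows "hconnected (hg_image f H)"
proof (rule hconnected_closedI[OF uniform_hg_image[OF u inj]])
  fix S assume S: "closed_in (hg_image f H) S" "S \<noteq> {}"
  define T where "T = {x \<in> verts H. f x \<in> S}"
  have "e \<subseteq> T" if e: "e \<in> edges H" "e \<inter> T \<noteq> {}" for e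
  proof -
    have "f ` e \<in> edges (hg_image f H)" "f ` e \<inter> S \<noteq> {}"
      using e by (auto simp: T_def)
    then have "f ` e \<subseteq> S" using S unfolding closed_in_def by blast
    then show ?thesis using uniform_edge(1)[OF u e(1)] by (auto simp: T_def)
  qed
  then have "closed_in H T" by (auto simp: closed_in_def T_def)
  moreover have "T \<noteq> {}" using S by (auto simp: closed_in_def T_def)
  ultimately have "T = verts H" using hconnected_closedD[OF u c] by blast
  then show "S = verts (hg_image f H)" using S by (auto simp: closed_in_def T_def)
qed

section \<open>Cut vertices and blocks\<close>

text \<open>The coalescence seen inside \<open>G\<close>: two sub-hypergraphs over the same vertex
  type sharing exactly \<open>u\<close>, instead of disjoint copies glued through
  \<open>option\<close>. The next lemmas show that \<open>u\<close> is a cut vertex exactly if such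
  a pair exists.\<close>

definition split_at :: "nat \<Rightarrow> 'a hypergraph \<Rightarrow> 'a \<Rightarrow> 'a hypergraph \<Rightarrow> 'a hypergraph \<Rightarrow> bool" where
  "split_at m G u H1 H2 \<longleftrightarrow>
     uniform_hypergraph m H1 \<and> hconnected H1 \<and> nontrivial H1 \<and>
     uniform_hypergraph m H2 \<and> hconnected H2 \<and> nontrivial H2 \<and>
     verts H1 \<inter> verts H2 = {u} \<and> verts G = verts H1 \<union> verts H2 \<and>
     edges G = edges H1 \<union> edges H2"

lemma split_at_commute: "split_at m G u H1 H2 \<longleftrightarrow> split_at m G u H2 H1"
  unfolding split_at_def by (metis Int_commute Un_commute)

text \<open>Both summands are carried back into \<open>G\<close> by first identifying
  \<open>w1\<close> with \<open>w2\<close> and then inverting the isomorphism.\<close>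

lemma cut_vertex_split:
  fixes G :: "'a hypergraph"
  assumes uni: "uniform_hypergraph m G" and cut: "cut_vertex m G u"
  obtains G1 G2 where "split_at m G u G1 G2"
proof -
  obtain H1 H2 :: "('a + 'a) hypergraph" and w1 w2 f where u: "u \<in> verts G"
    and H1: "uniform_hypergraph m H1" "hconnected H1" "nontrivial H1"
    and H2: "uniform_hypergraph m H2" "hconnected H2" "nontrivial H2"
    and disj: "verts H1 \<inter> verts H2 = {}" and w: "w1 \<in> verts H1" "w2 \<in> verts H2"
    and iso: "hg_iso f G (coalescence H1 w1 H2 w2)" and fu: "f u = None"
    using cut unfolding cut_vertex_def by blast
  define i where "i = identify w1 w2"
  define g where "g = inv_into (verts G) f"
  \<comment> \<open>This sends a vertex of a summand to the vertex of \<open>G\<close> that it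
    represents; \<open>w1\<close> and \<open>w2\<close> both go to \<open>u\<close>.\<close>
  define h where "h = g \<circ> i"
  have bij: "bij_betw f (verts G) (i ` (verts H1 \<union> verts H2))"
    and ed: "(\<lambda>e. i ` e) ` (edges H1 \<union> edges H2) = (\<lambda>e. f ` e) ` edges G"
    using iso by (auto simp: hg_iso_def coalescence_def i_def)
  have g: "bij_betw g (i ` (verts H1 \<union> verts H2)) (verts G)"
    unfolding g_def by (rule bij_betw_inv_into[OF bij])
  have gf: "g (f x) = x" if "x \<in> verts G" for x
    using bij that by (simp add: g_def bij_betw_def)
  \<comment> \<open>By disjointness each summand contains only one of \<open>w1\<close> and
    \<open>w2\<close>, so the identification merges nothing within a summand.\<close>
  have i1: "inj_on i (verts H1)" and i2: "inj_on i (verts H2)"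
    using disj w by (auto simp: inj_on_def i_def identify_def)
  have g_inj: "inj_on g (i ` (verts H1 \<union> verts H2))" using g by (simp add: bij_betw_def)
  have h1: "inj_on h (verts H1)" and h2: "inj_on h (verts H2)"
    unfolding h_def using i1 i2 g_inj
    by (auto intro!: comp_inj_on intro: inj_on_subset)
  have gN: "g None = u" using gf[OF u] fu by simp
  have "i ` verts H1 \<inter> i ` verts H2 = {None}"
    using disj w by (auto simp: i_def identify_def image_iff split: if_splits)
  then have int: "h ` verts H1 \<inter> h ` verts H2 = {u}"
    unfolding h_def image_comp[symmetric]
    using inj_on_image_Int[OF g_inj, of "i ` verts H1" "i ` verts H2"] gN by auto
  have ver: "verts G = h ` verts H1 \<union> h ` verts H2"
    using g unfolding bij_betw_def h_def image_comp[symmetric] by (simp add: image_Un)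
  \<comment> \<open>Undoing \<open>f\<close> edge by edge turns the equality of edge sets in the
    isomorphism into a description of \<open>edges G\<close> itself.\<close>
  have "g ` f ` e = e" if "e \<in> edges G" for e
    using gf uniform_edge(1)[OF uni that] by (force simp: image_image)
  then have "edges G = (\<lambda>e. g ` e) ` (\<lambda>e. f ` e) ` edges G"
    by (simp add: image_image)
  also have "\<dots> = (\<lambda>e. h ` e) ` (edges H1 \<union> edges H2)"
    unfolding ed[symmetric] by (simp add: image_image h_def)
  finally have edg: "edges G = (\<lambda>e. h ` e) ` edges H1 \<union> (\<lambda>e. h ` e) ` edges H2"
    by (simp add: image_Un)
  have "split_at m G u (hg_image h H1) (hg_image h H2)"
    unfolding split_at_def
    using uniform_hg_image[OF H1(1) h1] uniform_hg_image[OF H2(1) h2]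
      hconnected_hg_image[OF H1(1) h1 H1(2)] hconnected_hg_image[OF H2(1) h2 H2(2)]
      nontrivial_hg_image[OF h1] nontrivial_hg_image[OF h2] H1(3) H2(3) int ver edg
    by simp
  then show ?thesis by (rule that)
qed

text \<open>Tagging \<open>G1\<close> with \<open>Inl\<close> and \<open>G2\<close> with
  \<open>Inr\<close> makes them disjoint and doubles \<open>u\<close>; the coalescence at
  \<open>Inl u\<close> and \<open>Inr u\<close> merges the two copies again.\<close>

lemma split_cut_vertex:
  fixes G :: "'a hypergraph"
  assumes sp: "split_at m G u G1 G2"
  shows "cut_vertex m G u"
proof -
  define H1 :: "('a + 'a) hypergraph" where "H1 = hg_image Inl G1"
  define H2 :: "('a + 'a) hypergraph" where "H2 = hg_image Inr G2"
  define i where "i = identify (Inl u :: 'a + 'a) (Inr u)"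
  define f where "f x = (if x = u then None
    else if x \<in> verts G1 then Some (Inl x :: 'a + 'a) else Some (Inr x))" for x
  have G1: "uniform_hypergraph m G1" "hconnected G1" "nontrivial G1"
    and G2: "uniform_hypergraph m G2" "hconnected G2" "nontrivial G2"
    and int: "verts G1 \<inter> verts G2 = {u}" and ver: "verts G = verts G1 \<union> verts G2"
    and edg: "edges G = edges G1 \<union> edges G2"
    using sp by (auto simp: split_at_def)
  have f1: "i (Inl x) = f x" if "x \<in> verts G1" for x
    using that by (auto simp: i_def f_def identify_def)
  have f2: "i (Inr x) = f x" if "x \<in> verts G2" for x
    using that int by (auto simp: i_def f_def identify_def)
  have "inj_on f (verts G)"
    by (auto simp: inj_on_def f_def split: if_splits)
  moreover have "f ` verts G = i ` (verts H1 \<union> verts H2)"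
    using f1 f2 by (simp add: ver H1_def H2_def image_Un image_image)
  moreover have "i ` Inl ` e = f ` e" if "e \<in> edges G1" for e
    using f1 uniform_edge(1)[OF G1(1) that] by (force simp: image_image)
  moreover have "i ` Inr ` e = f ` e" if "e \<in> edges G2" for e
    using f2 uniform_edge(1)[OF G2(1) that] by (force simp: image_image)
  ultimately have "hg_iso f G (coalescence H1 (Inl u) H2 (Inr u))"
    unfolding hg_iso_def coalescence_def i_def[symmetric]
    by (simp add: bij_betw_def edg H1_def H2_def image_Un image_image)
  moreover have "f u = None" by (simp add: f_def)
  moreover have "uniform_hypergraph m H1" "hconnected H1" "nontrivial H1"
    unfolding H1_def using G1 uniform_hg_image hconnected_hg_image nontrivial_hg_image
    by (metis inj_Inl inj_on_subset subset_UNIV)+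
  moreover have "uniform_hypergraph m H2" "hconnected H2" "nontrivial H2"
    unfolding H2_def using G2 uniform_hg_image hconnected_hg_image nontrivial_hg_image
    by (metis inj_Inr inj_on_subset subset_UNIV)+
  moreover have "verts H1 \<inter> verts H2 = {}" by (auto simp: H1_def H2_def)
  moreover have "Inl u \<in> verts H1" "Inr u \<in> verts H2" "u \<in> verts G"
    using int ver by (auto simp: H1_def H2_def)
  ultimately show ?thesis unfolding cut_vertex_def by blast
qed

lemma split_edge_subset:
  assumes "split_at m G u G1 G2"
  shows "e \<in> edges G1 \<Longrightarrow> e \<subseteq> verts G1" "e \<in> edges G2 \<Longrightarrow> e \<subseteq> verts G2"
  using assms uniform_edge(1)[of m G1 e] uniform_edge(1)[of m G2 e]
  by (simp_all add: split_at_def)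

text \<open>A common edge would be contained in \<open>{u}\<close>, but edges have at least two
  elements.\<close>

lemma split_edges_disjoint:
  assumes sp: "split_at m G u G1 G2" and m: "m \<ge> 2"
  shows "edges G1 \<inter> edges G2 = {}"
proof -
  have False if e: "e \<in> edges G1" "e \<in> edges G2" for e
  proof -
    have "uniform_hypergraph m G1" "verts G1 \<inter> verts G2 = {u}"
      using sp by (simp_all add: split_at_def)
    then have "e \<subseteq> {u}" "card e = m"
      using e split_edge_subset[OF sp, of e] uniform_edge(2)[of m G1 e] by auto
    then show False using m card_mono[of "{u}" e] by simp
  qed
  then show ?thesis by blast
qed

lemma split_edges_nonempty:
  assumes "split_at m G u G1 G2"
  shows "edges G1 \<noteq> {}" "edges G2 \<noteq> {}"
  using assms hconnected_nontrivial_edges[of m G1] hconnected_nontrivial_edges[of m G2]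
  by (simp_all add: split_at_def)

lemma split_uniform:
  assumes "split_at m G u G1 G2"
  shows "uniform_hypergraph m G"
  using assms by (auto simp: split_at_def uniform_hypergraph_def)

section \<open>Sub-hypergraphs of a hypergraph split at a vertex\<close>

definition hg_inter :: "'a hypergraph \<Rightarrow> 'a hypergraph \<Rightarrow> 'a hypergraph" where
  "hg_inter H K = Hypergraph (verts H \<inter> verts K) (edges H \<inter> edges K)"

lemma hg_inter_sel [simp]:
  "verts (hg_inter H K) = verts H \<inter> verts K" "edges (hg_inter H K) = edges H \<inter> edges K"
  by (simp_all add: hg_inter_def)

text \<open>Every passage from one side to the other goes through \<open>u\<close>. If
  \<open>H\<close> avoided \<open>u\<close>, its vertices in \<open>G1\<close> would form a nonempty
  closed set, hence all of \<open>H\<close>, which contradicts the edge of \<open>H\<close> in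
  \<open>G2\<close>.\<close>

lemma split_vertex_in_sub:
  assumes sp: "split_at m G u G1 G2" and H: "sub_hypergraph m H G" "hconnected H"
    and m: "m \<ge> 2" and e1: "edges H \<inter> edges G1 \<noteq> {}" and e2: "edges H \<inter> edges G2 \<noteq> {}"
  shows "u \<in> verts H"
proof (rule ccontr)
  assume u: "u \<notin> verts H"
  have uH: "uniform_hypergraph m H" using H by (simp add: sub_hypergraph_def)
  note sub1 = split_edge_subset(1)[OF sp]
  note sub2 = split_edge_subset(2)[OF sp]
  have int: "verts G1 \<inter> verts G2 = {u}" using sp by (simp add: split_at_def)
  then have meet: "x = u" if "x \<in> verts G1" "x \<in> verts G2" for x using that by blast
  have E: "edges H \<subseteq> edges G1 \<union> edges G2"
    using sp H by (auto simp: split_at_def sub_hypergraph_def)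
  have ne: "e \<noteq> {}" if "e \<in> edges H" for e
    using uniform_edge(2)[OF uH that] m by auto
  have "e \<subseteq> verts H \<inter> verts G1"
    if e: "e \<in> edges H" "e \<inter> (verts H \<inter> verts G1) \<noteq> {}" for e
  proof (cases "e \<in> edges G1")
    case True
    then show ?thesis using sub1[OF True] uniform_edge(1)[OF uH e(1)] by simp
  next
    case False
    \<comment> \<open>An edge of the other side could meet \<open>G1\<close> only in
      \<open>u\<close>, which is not a vertex of \<open>H\<close>.\<close>
    then have "e \<subseteq> verts G2" using E e(1) sub2[of e] by blast
    then show ?thesis using e(2) u meet by blast
  qed
  then have "closed_in H (verts H \<inter> verts G1)" by (auto simp: closed_in_def)
  moreover have "verts H \<inter> verts G1 \<noteq> {}"
  proof -
    obtain e where "e \<in> edges H" "e \<in> edges G1" using e1 by blast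
    then show ?thesis using ne[of e] sub1[of e] uniform_edge(1)[OF uH, of e] by blast
  qed
  ultimately have "verts H \<subseteq> verts G1"
    using hconnected_closedD[OF uH H(2)] by blast
  moreover obtain e where "e \<in> edges H" "e \<in> edges G2" using e2 by blast
  ultimately show False
    using ne[of e] sub2[of e] uniform_edge(1)[OF uH, of e] meet u by blast
qed

text \<open>A closed set of the intersection that contains \<open>u\<close> becomes closed in
  \<open>H\<close> once all vertices of \<open>H\<close> in \<open>G2\<close> are added, because the
  two sides meet only in \<open>u\<close>. Connectivity of \<open>H\<close> then forces the set to
  be everything.\<close>

lemma hconnected_hg_inter_split:
  assumes sp: "split_at m G u G1 G2" and H: "sub_hypergraph m H G" "hconnected H"
    and u: "u \<in> verts H"
  shows "uniform_hypergraph m (hg_inter H G1)" "hconnected (hg_inter H G1)"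
proof -
  have uH: "uniform_hypergraph m H" using H by (simp add: sub_hypergraph_def)
  note sub1 = split_edge_subset(1)[OF sp]
  note sub2 = split_edge_subset(2)[OF sp]
  have int: "verts G1 \<inter> verts G2 = {u}" using sp by (simp add: split_at_def)
  then have meet: "x = u" if "x \<in> verts G1" "x \<in> verts G2" for x using that by blast
  have E: "edges H \<subseteq> edges G1 \<union> edges G2"
    using sp H by (auto simp: split_at_def sub_hypergraph_def)
  show uni: "uniform_hypergraph m (hg_inter H G1)"
    using uH u int sub1 unfolding uniform_hypergraph_def by auto
  have *: "S = verts (hg_inter H G1)" if S: "closed_in (hg_inter H G1) S" "u \<in> S" for S
  proof -
    have S1: "S \<subseteq> verts H \<inter> verts G1" using S by (simp add: closed_in_def)
    have "e \<subseteq> S \<union> (verts H \<inter> verts G2)"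
      if e: "e \<in> edges H" "e \<inter> (S \<union> (verts H \<inter> verts G2)) \<noteq> {}" for e
    proof (cases "e \<in> edges G1")
      case True
      then have "e \<inter> S \<noteq> {}" using e(2) sub1[OF True] meet S(2) by blast
      then show ?thesis using S(1) True e(1) by (auto simp: closed_in_def)
    next
      case False
      then show ?thesis using E e(1) sub2[of e] uniform_edge(1)[OF uH e(1)] by blast
    qed
    then have "closed_in H (S \<union> (verts H \<inter> verts G2))"
      using S1 by (auto simp: closed_in_def)
    then have "S \<union> (verts H \<inter> verts G2) = verts H"
      using hconnected_closedD[OF uH H(2)] S(2) by blast
    then show ?thesis using S1 meet S(2) by auto
  qed
  show "hconnected (hg_inter H G1)"
  proof (rule hconnected_closedI[OF uni])
    fix S assume S: "closed_in (hg_inter H G1) S" "S \<noteq> {}"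
    show "S = verts (hg_inter H G1)"
    proof (cases "u \<in> S")
      case True
      then show ?thesis using * S by blast
    next
      case False
      \<comment> \<open>Complements of closed sets are closed. This one contains \<open>u\<close>,
        so it is everything, and \<open>S\<close> would be empty.\<close>
      let ?T = "verts (hg_inter H G1) - S"
      have "closed_in (hg_inter H G1) ?T"
        using S uniform_edge(1)[OF uni] unfolding closed_in_def by blast
      moreover have "u \<in> ?T" using u int False by auto
      ultimately have "?T = verts (hg_inter H G1)" by (rule *)
      then show ?thesis using S by (auto simp: closed_in_def)
    qed
  qed
qed

text \<open>If \<open>H\<close> had edges on both sides, it would contain \<open>u\<close> and split
  there into its intersections with \<open>G1\<close> and \<open>G2\<close>, so \<open>u\<close>
  would be a cut vertex of \<open>H\<close>. Hence all edges lie on one side, and the vertices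
  follow because they are covered by edges.\<close>

lemma split_sub_without_cut:
  assumes sp: "split_at m G u G1 G2" and H: "conn_sub_without_cut m H G"
    and m: "m \<ge> 2" and ne: "edges H \<noteq> {}"
  shows "conn_sub_without_cut m H G1 \<or> conn_sub_without_cut m H G2"
proof -
  have sub: "sub_hypergraph m H G" and con: "hconnected H" and nc: "\<nexists>u. cut_vertex m H u"
    using H by (auto simp: conn_sub_without_cut_def)
  have uH: "uniform_hypergraph m H" using sub by (simp add: sub_hypergraph_def)
  have E: "edges H \<subseteq> edges G1 \<union> edges G2" and V: "verts H \<subseteq> verts G1 \<union> verts G2"
    using sp sub by (auto simp: split_at_def sub_hypergraph_def)
  have "edges H \<inter> edges G1 = {} \<or> edges H \<inter> edges G2 = {}"
  proof (rule ccontr)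
    assume "\<not> ?thesis"
    then have e1: "edges H \<inter> edges G1 \<noteq> {}" and e2: "edges H \<inter> edges G2 \<noteq> {}" by auto
    have u: "u \<in> verts H" by (rule split_vertex_in_sub[OF sp sub con m e1 e2])
    have 1: "uniform_hypergraph m (hg_inter H G1)" "hconnected (hg_inter H G1)"
      using hconnected_hg_inter_split[OF sp sub con u] by auto
    have 2: "uniform_hypergraph m (hg_inter H G2)" "hconnected (hg_inter H G2)"
      using hconnected_hg_inter_split[OF sp[THEN split_at_commute[THEN iffD1]] sub con u] by auto
    have "nontrivial (hg_inter H G1)" "nontrivial (hg_inter H G2)"
      using edges_nontrivial[OF 1(1)] edges_nontrivial[OF 2(1)] e1 e2 m by auto
    moreover have "verts G1 \<inter> verts G2 = {u}" using sp by (simp add: split_at_def)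
    ultimately have "split_at m H u (hg_inter H G1) (hg_inter H G2)"
      unfolding split_at_def using 1 2 u E V by auto
    then show False using nc split_cut_vertex by metis
  qed
  then have or: "edges H \<subseteq> edges G1 \<or> edges H \<subseteq> edges G2" using E by blast
  have V: "verts H = \<Union> (edges H)" using verts_eq_Union_edges[OF uH con ne] m by simp
  have "conn_sub_without_cut m H K" if "edges H \<subseteq> edges K" "uniform_hypergraph m K" for K
  proof -
    have "verts H \<subseteq> verts K" unfolding V using uniform_edge(1)[OF that(2)] that(1) by blast
    then show ?thesis using uH con nc that
      by (simp add: conn_sub_without_cut_def sub_hypergraph_def)
  qed
  then show ?thesis using or sp by (auto simp: split_at_def)
qed

section \<open>Blocks of a split hypergraph and of one without cut vertices\<close>

text \<open>A split needs an edge on each side and the two edge sets are disjoint, so one edge is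
  too few.\<close>

lemma single_edge_without_cut:
  assumes u: "uniform_hypergraph m G" and e: "e \<in> edges G" and m: "m \<ge> 2"
  shows "conn_sub_without_cut m (Hypergraph e {e}) G"
proof -
  have "finite e" "e \<noteq> {}" "card e = m"
    using uniform_edge[OF u e] m u by (auto simp: uniform_hypergraph_def intro: finite_subset)
  then have uni: "uniform_hypergraph m (Hypergraph e {e})" by (simp add: uniform_hypergraph_def)
  have "hconnected (Hypergraph e {e})"
    by (rule hconnected_closedI[OF uni]) (auto simp: closed_in_def)
  moreover have "\<not> cut_vertex m (Hypergraph e {e}) v" for v
  proof
    assume "cut_vertex m (Hypergraph e {e}) v"
    then obtain G1 G2 where sp: "split_at m (Hypergraph e {e}) v G1 G2"
      using cut_vertex_split[OF uni] by blast
    then have "edges G1 \<union> edges G2 = {e}" unfolding split_at_def by auto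
    then show False using split_edges_nonempty[OF sp] split_edges_disjoint[OF sp m]
      by (metis Un_empty inf.idem singleton_Un_iff)
  qed
  ultimately show ?thesis
    using uni e uniform_edge(1)[OF u e] by (simp add: conn_sub_without_cut_def sub_hypergraph_def)
qed

text \<open>An isolated vertex is also connected and free of cut vertices, but a single edge of
  \<open>G\<close> is a strictly larger competitor.\<close>

lemma block_edges_nonempty:
  assumes "uniform_hypergraph m G" "edges G \<noteq> {}" "m \<ge> 2" "block m B G"
  shows "edges B \<noteq> {}"
proof
  assume "edges B = {}"
  moreover obtain e where "e \<in> edges G" using assms by blast
  ultimately show False
    using single_edge_without_cut[OF assms(1) _ assms(3)] assms(4) unfolding block_def
    by fastforce
qed

text \<open>A connected sub-hypergraph with edges and without cut vertices lies within one side, so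
  maximality in \<open>G\<close> and maximality in that side coincide. No block belongs to both
  sides, since it has an edge and the edge sets are disjoint.\<close>

lemma blocks_split:
  fixes G :: "'a hypergraph"
  assumes sp: "split_at m G u G1 G2" and m: "m \<ge> 2"
  shows "{B. block m B G} = {B. block m B G1} \<union> {B. block m B G2}"
    and "{B. block m B G1} \<inter> {B. block m B G2} = {}"
proof -
  have uG: "uniform_hypergraph m G" using split_uniform[OF sp] .
  have u12: "uniform_hypergraph m G1" "uniform_hypergraph m G2"
    using sp by (auto simp: split_at_def)
  note ne12 = split_edges_nonempty[OF sp]
  have ne: "edges G \<noteq> {}" using ne12 sp by (auto simp: split_at_def)
  have disj: "edges G1 \<inter> edges G2 = {}" by (rule split_edges_disjoint[OF sp m])
  have up: "conn_sub_without_cut m H G"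
    if "conn_sub_without_cut m H G1 \<or> conn_sub_without_cut m H G2" for H
    using that sp by (auto simp: conn_sub_without_cut_def sub_hypergraph_def split_at_def)
  have edges_sub: "edges B \<subseteq> edges K" if "conn_sub_without_cut m B K" for B K :: "'a hypergraph"
    using that by (simp add: conn_sub_without_cut_def sub_hypergraph_def)
  have blk: "conn_sub_without_cut m B K" if "block m B K" for B K :: "'a hypergraph"
    using that by (simp add: block_def)
  \<comment> \<open>The sides are left general so that symmetry of the split yields the case of
    \<open>G2\<close>. A larger competitor lies in \<open>K1\<close>, against maximality there, or
    in \<open>K2\<close>, which would put the edges of \<open>B\<close> on both sides.\<close>
  have lift: "block m B G"
    if sp': "split_at m G u K1 K2" and B: "block m B K1" for B K1 K2
  proof -
    have K1: "uniform_hypergraph m K1" using sp' by (simp add: split_at_def)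
    have neB: "edges B \<noteq> {}"
      using block_edges_nonempty[OF K1 split_edges_nonempty(1)[OF sp'] m B] .
    have "\<not> edges B \<subset> edges H" if H: "conn_sub_without_cut m H G" for H
    proof
      assume lt: "edges B \<subset> edges H"
      then have "edges H \<noteq> {}" by blast
      then have "conn_sub_without_cut m H K1 \<or> conn_sub_without_cut m H K2"
        using split_sub_without_cut[OF sp' H m] by blast
      then show False
      proof
        assume "conn_sub_without_cut m H K1"
        then show False using B lt by (auto simp: block_def)
      next
        assume "conn_sub_without_cut m H K2"
        then have "edges B \<subseteq> edges K2" using edges_sub lt by blast
        moreover have "edges B \<subseteq> edges K1" using edges_sub blk B by blast
        ultimately show False using split_edges_disjoint[OF sp' m] neB by blast
      qed
    qed
    moreover have "conn_sub_without_cut m B G"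
      using blk[OF B] sp'
      by (auto simp: conn_sub_without_cut_def sub_hypergraph_def split_at_def)
    ultimately show ?thesis by (simp add: block_def)
  qed
  show "{B. block m B G} = {B. block m B G1} \<union> {B. block m B G2}"
  proof (intro equalityI subsetI)
    fix B assume "B \<in> {B. block m B G}"
    then have B: "block m B G" by simp
    have "conn_sub_without_cut m B G1 \<or> conn_sub_without_cut m B G2"
      using split_sub_without_cut[OF sp blk[OF B] m block_edges_nonempty[OF uG ne m B]] .
    then show "B \<in> {B. block m B G1} \<union> {B. block m B G2}"
      using B up by (auto simp: block_def)
  next
    fix B assume "B \<in> {B. block m B G1} \<union> {B. block m B G2}"
    then show "B \<in> {B. block m B G}"
      using lift[OF sp] lift[OF sp[THEN split_at_commute[THEN iffD1]]] by blast
  qed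
  show "{B. block m B G1} \<inter> {B. block m B G2} = {}"
    using block_edges_nonempty[OF u12(1) ne12(1) m] edges_sub blk disj by blast
qed

text \<open>\<open>G\<close> competes with each of its blocks, so a block has all edges of
  \<open>G\<close>, and by connectivity all of its vertices.\<close>

lemma blocks_without_cut:
  assumes u: "uniform_hypergraph m G" and c: "hconnected G" and ne: "edges G \<noteq> {}"
    and m: "m \<ge> 2" and nc: "\<nexists>u. cut_vertex m G u"
  shows "{B. block m B G} = {G}"
proof -
  have G: "conn_sub_without_cut m G G"
    using assms by (simp add: conn_sub_without_cut_def sub_hypergraph_def)
  have "B = G" if B: "block m B G" for B
  proof -
    have c': "conn_sub_without_cut m B G" using B by (simp add: block_def)
    then have uB: "uniform_hypergraph m B" "hconnected B" "edges B \<subseteq> edges G"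
      by (auto simp: conn_sub_without_cut_def sub_hypergraph_def)
    have eq: "edges B = edges G" using B G uB(3) by (auto simp: block_def)
    then have "verts B = verts G"
      using verts_eq_Union_edges[OF uB(1,2)] verts_eq_Union_edges[OF u c] ne m by simp
    then show ?thesis using eq by (simp add: hypergraph.expand)
  qed
  moreover have "block m G G" unfolding block_def
    using G by (auto simp: conn_sub_without_cut_def sub_hypergraph_def)
  ultimately show ?thesis by blast
qed

section \<open>Stabilizing functions\<close>

text \<open>The edge condition is the stabilizing equation for an entry with first index
  \<open>x\<close>, multiplied by \<open>d x ^ m\<close>. The values off the vertex set are fixed by
  \<open>extensional\<close>, so that counting functions counts diagonals; \<open>r\<close> is the
  vertex of normalization.\<close>

definition stab_fns :: "nat \<Rightarrow> 'a hypergraph \<Rightarrow> 'a \<Rightarrow> ('a \<Rightarrow> complex) set" where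
  "stab_fns m H r = {d \<in> extensional (verts H). (\<forall>x\<in>verts H. d x \<noteq> 0) \<and> d r = 1 \<and>
     (\<forall>e\<in>edges H. \<forall>x\<in>e. d x ^ m = (\<Prod>y\<in>e. d y))}"

text \<open>Both sides of an edge equation are homogeneous of degree \<open>m\<close>, as every edge
  has \<open>m\<close> elements. Dividing by the value at the new base vertex therefore preserves
  solutions.\<close>

lemma card_stab_fns_base:
  fixes H :: "'a hypergraph"
  assumes u: "uniform_hypergraph m H" and r: "r \<in> verts H" and q: "q \<in> verts H"
  shows "card (stab_fns m H r) = card (stab_fns m H q)"
proof -
  define \<phi> where "\<phi> p d = restrict (\<lambda>x. d x / d p) (verts H)" for p and d :: "'a \<Rightarrow> complex"
  have maps: "\<phi> p d \<in> stab_fns m H p" if d: "d \<in> stab_fns m H p'" and p: "p \<in> verts H" for p p' d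
  proof -
    have "\<phi> p d x ^ m = (\<Prod>y\<in>e. \<phi> p d y)" if e: "e \<in> edges H" "x \<in> e" for e x
    proof -
      have "(\<Prod>y\<in>e. \<phi> p d y) = (\<Prod>y\<in>e. d y / d p)"
        using uniform_edge(1)[OF u e(1)] by (intro prod.cong) (auto simp: \<phi>_def)
      also have "\<dots> = (\<Prod>y\<in>e. d y) / d p ^ m"
        using uniform_edge(2)[OF u e(1)] by (simp add: prod_dividef)
      also have "(\<Prod>y\<in>e. d y) = d x ^ m" using d e by (simp add: stab_fns_def)
      finally show ?thesis
        using uniform_edge(1)[OF u e(1)] e(2) by (auto simp: \<phi>_def power_divide)
    qed
    then show ?thesis using d p by (auto simp: stab_fns_def \<phi>_def)
  qed
  \<comment> \<open>The factor \<open>1 / d p\<close> cancels in the quotient of two values, and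
    \<open>d p' = 1\<close> does the rest.\<close>
  have inv: "\<phi> p' (\<phi> p d) = d"
    if d: "d \<in> stab_fns m H p'" and p: "p \<in> verts H" "p' \<in> verts H" for p p' d
  proof
    fix x
    show "\<phi> p' (\<phi> p d) x = d x"
      using d p by (cases "x \<in> verts H") (auto simp: stab_fns_def \<phi>_def extensional_def)
  qed
  have "bij_betw (\<phi> q) (stab_fns m H r) (stab_fns m H q)"
    by (rule bij_betw_byWitness[where f' = "\<phi> r"]) (use maps inv r q in auto)
  then show ?thesis by (rule bij_betw_same_card)
qed

text \<open>Every edge equation involves one side only. Two solutions normalized at \<open>u\<close>
  agree at the single shared vertex, so they glue to exactly one solution on
  \<open>G\<close>.\<close>

lemma card_stab_fns_split:
  fixes G :: "'a hypergraph"
  assumes sp: "split_at m G u G1 G2"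
  shows "card (stab_fns m G u) = card (stab_fns m G1 u) * card (stab_fns m G2 u)"
proof -
  define \<phi> where "\<phi> d = (restrict d (verts G1), restrict d (verts G2))" for d :: "'a \<Rightarrow> complex"
  \<comment> \<open>Outside \<open>verts G\<close> this takes the value of the second component,
    which is \<open>undefined\<close> by extensionality, so the glued function is extensional as
    well.\<close>
  define \<psi> where "\<psi> p x = (if x \<in> verts G1 then fst p x else snd p x)"
    for p :: "('a \<Rightarrow> complex) \<times> ('a \<Rightarrow> complex)" and x
  note sub1 = split_edge_subset(1)[OF sp]
  note sub2 = split_edge_subset(2)[OF sp]
  have int: "verts G1 \<inter> verts G2 = {u}" and V: "verts G = verts G1 \<union> verts G2"
    and E: "edges G = edges G1 \<union> edges G2"
    using sp by (auto simp: split_at_def)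
  have u12: "u \<in> verts G1" "u \<in> verts G2" using int by auto
  have res: "restrict d (verts K) \<in> stab_fns m K u"
    if d: "d \<in> stab_fns m G u" and K: "verts K \<subseteq> verts G" "edges K \<subseteq> edges G" "u \<in> verts K"
      "\<And>e. e \<in> edges K \<Longrightarrow> e \<subseteq> verts K" for d K
  proof -
    have "restrict d (verts K) x ^ m = (\<Prod>y\<in>e. restrict d (verts K) y)"
      if e: "e \<in> edges K" "x \<in> e" for e x
    proof -
      have "(\<Prod>y\<in>e. restrict d (verts K) y) = (\<Prod>y\<in>e. d y)"
        using K(4)[OF e(1)] by (intro prod.cong) auto
      also have "\<dots> = d x ^ m" using d e K(2) unfolding stab_fns_def by auto
      finally show ?thesis using K(4)[OF e(1)] e(2) by auto
    qed
    then show ?thesis using d K by (auto simp: stab_fns_def)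
  qed
  have glue: "\<psi> p \<in> stab_fns m G u" and unglue: "\<phi> (\<psi> p) = p"
    if p: "p \<in> stab_fns m G1 u \<times> stab_fns m G2 u" for p
  proof -
    obtain a b where ab: "p = (a, b)" "a \<in> stab_fns m G1 u" "b \<in> stab_fns m G2 u"
      using p by blast
    have \<psi>1: "\<psi> p x = a x" if "x \<in> verts G1" for x using that ab by (simp add: \<psi>_def)
    have \<psi>2: "\<psi> p x = b x" if "x \<in> verts G2" for x
    proof (cases "x \<in> verts G1")
      case True
      then have "x = u" using that int by blast
      then show ?thesis using ab u12 by (simp add: \<psi>_def stab_fns_def)
    qed (use ab in \<open>simp add: \<psi>_def\<close>)
    have "\<psi> p x ^ m = (\<Prod>y\<in>e. \<psi> p y)" if e: "e \<in> edges G1" "x \<in> e" for e x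
    proof -
      have "(\<Prod>y\<in>e. \<psi> p y) = (\<Prod>y\<in>e. a y)"
        using sub1[OF e(1)] \<psi>1 by (intro prod.cong) auto
      then show ?thesis using ab(2) e sub1[OF e(1)] \<psi>1 by (auto simp: stab_fns_def)
    qed
    moreover have "\<psi> p x ^ m = (\<Prod>y\<in>e. \<psi> p y)" if e: "e \<in> edges G2" "x \<in> e" for e x
    proof -
      have "(\<Prod>y\<in>e. \<psi> p y) = (\<Prod>y\<in>e. b y)"
        using sub2[OF e(1)] \<psi>2 by (intro prod.cong) auto
      then show ?thesis using ab(3) e sub2[OF e(1)] \<psi>2 by (auto simp: stab_fns_def)
    qed
    moreover have "\<psi> p x \<noteq> 0" if "x \<in> verts G" for x
      using that ab \<psi>1 \<psi>2 V by (auto simp: stab_fns_def)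
    moreover have "\<psi> p u = 1" using \<psi>1 u12 ab by (simp add: stab_fns_def)
    moreover have "\<psi> p \<in> extensional (verts G)"
      using ab V by (auto simp: extensional_def stab_fns_def \<psi>_def)
    ultimately show "\<psi> p \<in> stab_fns m G u" using E by (auto simp: stab_fns_def)
    show "\<phi> (\<psi> p) = p"
      using ab \<psi>1 \<psi>2 by (auto simp: \<phi>_def stab_fns_def extensional_def fun_eq_iff)
  qed
  have "bij_betw \<phi> (stab_fns m G u) (stab_fns m G1 u \<times> stab_fns m G2 u)"
  proof (rule bij_betw_byWitness[where f' = \<psi>])
    show "\<forall>d\<in>stab_fns m G u. \<psi> (\<phi> d) = d"
      using V by (auto simp: \<phi>_def \<psi>_def stab_fns_def extensional_def fun_eq_iff)
    show "\<phi> ` stab_fns m G u \<subseteq> stab_fns m G1 u \<times> stab_fns m G2 u"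
      using res sub1 sub2 u12 V E by (auto simp: \<phi>_def)
  qed (use glue unglue in auto)
  then show ?thesis using bij_betw_same_card card_cartesian_product by metis
qed

section \<open>Counting stabilizing functions over the blocks\<close>

text \<open>Different blocks need not share a vertex, so a product over blocks calls for a count
  without a prescribed base vertex. The choice is immaterial for uniform hypergraphs by
  \<open>card_stab_fns_base\<close>.\<close>

definition stab_number :: "nat \<Rightarrow> 'a hypergraph \<Rightarrow> nat" where
  "stab_number m H = card (stab_fns m H (SOME r. r \<in> verts H))"

lemma stab_number_eq:
  assumes "uniform_hypergraph m H" "r \<in> verts H"
  shows "stab_number m H = card (stab_fns m H r)"
  unfolding stab_number_def
  using card_stab_fns_base[OF assms(1) _ assms(2)] someI[of "\<lambda>r. r \<in> verts H"] assms(2) by blast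

text \<open>All three counts are evaluated at \<open>u\<close>, which is a vertex of each
  hypergraph.\<close>

lemma stab_number_split:
  assumes sp: "split_at m G u G1 G2"
  shows "stab_number m G = stab_number m G1 * stab_number m G2"
proof -
  have "uniform_hypergraph m G1" "uniform_hypergraph m G2" "u \<in> verts G1" "u \<in> verts G2"
    "u \<in> verts G"
    using sp by (auto simp: split_at_def)
  then show ?thesis
    using card_stab_fns_split[OF sp] stab_number_eq split_uniform[OF sp] by metis
qed

text \<open>Strong induction on the number of vertices: without a cut vertex \<open>G\<close> is its
  only block, and otherwise both sides of a split are smaller. Finiteness is carried along because
  the product over a disjoint union is broken up only for finite sets.\<close>

lemma stab_number_blocks:
  assumes "uniform_hypergraph m G" "hconnected G" "nontrivial G" and m: "m \<ge> 2"
  shows "finite {B. block m B G} \<and> stab_number m G = (\<Prod>B | block m B G. stab_number m B)"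
  using assms(1-3)
proof (induction "card (verts G)" arbitrary: G rule: less_induct)
  case less
  show ?case
  proof (cases "\<exists>u. cut_vertex m G u")
    case False
    then have "{B. block m B G} = {G}"
      using blocks_without_cut[OF less.prems(1,2)] hconnected_nontrivial_edges[OF less.prems] m
      by blast
    then show ?thesis by simp
  next
    case True
    then obtain u G1 G2 where sp: "split_at m G u G1 G2"
      using cut_vertex_split[OF less.prems(1)] by blast
    have V: "verts G1 \<inter> verts G2 = {u}" "verts G = verts G1 \<union> verts G2"
      and fin: "finite (verts G1)" "finite (verts G2)"
      and nt: "card (verts G1) > 1" "card (verts G2) > 1"
      using sp by (auto simp: split_at_def uniform_hypergraph_def nontrivial_def)
    \<comment> \<open>The shared vertex \<open>u\<close> is counted twice. As each side has at least
      two vertices, the other side is smaller than \<open>G\<close>.\<close>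
    have "card (verts G1) + card (verts G2) = card (verts G) + 1"
      using card_Un_Int[OF fin] V by simp
    then have lt: "card (verts G1) < card (verts G)" "card (verts G2) < card (verts G)"
      using nt by auto
    have "finite {B. block m B G1} \<and> stab_number m G1 = (\<Prod>B | block m B G1. stab_number m B)"
      "finite {B. block m B G2} \<and> stab_number m G2 = (\<Prod>B | block m B G2. stab_number m B)"
      using less.hyps[OF lt(1)] less.hyps[OF lt(2)] sp by (auto simp: split_at_def)
    then show ?thesis
      using blocks_split[OF sp m] stab_number_split[OF sp] by (simp add: prod.union_disjoint)
  qed
qed

section \<open>The stabilizer of the adjacency tensor\<close>

definition fn_mat :: "'a list \<Rightarrow> ('a \<Rightarrow> complex) \<Rightarrow> complex mat" where
  "fn_mat vs d = mat (length vs) (length vs) (\<lambda>(i, j). if i = j then d (vs ! i) else 0)"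

lemma fn_mat_carrier: "fn_mat vs d \<in> carrier_mat (length vs) (length vs)"
  by (simp add: fn_mat_def)

lemma fn_mat_mult_index:
  assumes B: "B \<in> carrier_mat (length vs) (length vs)" and ij: "i < length vs" "j < length vs"
  shows "(fn_mat vs d * B) $$ (i, j) = d (vs ! i) * B $$ (i, j)"
proof -
  have "(fn_mat vs d * B) $$ (i, j) =
      (\<Sum>k = 0..<length vs. (if i = k then d (vs ! i) else 0) * B $$ (k, j))"
    using B ij by (simp add: fn_mat_def scalar_prod_def)
  also have "\<dots> = (\<Sum>k = 0..<length vs. if i = k then d (vs ! i) * B $$ (k, j) else 0)"
    by (intro sum.cong) auto
  also have "\<dots> = d (vs ! i) * B $$ (i, j)" using ij by simp
  finally show ?thesis .
qed

text \<open>The diagonal entries of a product with an inverse read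
  \<open>d x * B $$ (i, i) = 1\<close>; conversely the diagonal matrix of the reciprocals is an
  inverse.\<close>

lemma invertible_fn_mat: "invertible_mat (fn_mat vs d) \<longleftrightarrow> (\<forall>x\<in>set vs. d x \<noteq> 0)"
proof
  let ?n = "length vs"
  assume "invertible_mat (fn_mat vs d)"
  then obtain B where AB: "fn_mat vs d * B = 1\<^sub>m ?n" and BA: "B * fn_mat vs d = 1\<^sub>m (dim_row B)"
    using fn_mat_carrier[of vs d] by (auto simp: invertible_mat_def inverts_mat_def)
  \<comment> \<open>Invertibility provides \<open>B\<close> without its dimensions; they are read
    off from the two products.\<close>
  have "dim_col B = ?n" using AB by (metis index_mult_mat(3) index_one_mat(3))
  moreover have "dim_row B = ?n"
    using BA fn_mat_carrier[of vs d] by (metis carrier_matD(2) index_mult_mat(3) index_one_mat(3))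
  ultimately have B: "B \<in> carrier_mat ?n ?n" by blast
  show "\<forall>x\<in>set vs. d x \<noteq> 0"
  proof
    fix x assume "x \<in> set vs"
    then obtain i where i: "i < ?n" "vs ! i = x" by (metis in_set_conv_nth)
    then have "d x * B $$ (i, i) = 1" using fn_mat_mult_index[OF B, of i i d] AB by simp
    then show "d x \<noteq> 0" by auto
  qed
next
  assume nz: "\<forall>x\<in>set vs. d x \<noteq> 0"
  have inv: "fn_mat vs a * fn_mat vs b = 1\<^sub>m (length vs)"
    if "\<forall>x\<in>set vs. a x * b x = 1" for a b
  proof (rule eq_matI)
    fix i j assume "i < dim_row (1\<^sub>m (length vs) :: complex mat)"
      "j < dim_col (1\<^sub>m (length vs) :: complex mat)"
    then have ij: "i < length vs" "j < length vs" by auto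
    then show "(fn_mat vs a * fn_mat vs b) $$ (i, j) = 1\<^sub>m (length vs) $$ (i, j)"
      using fn_mat_mult_index[OF fn_mat_carrier ij] that by (simp add: fn_mat_def)
  qed (simp_all add: fn_mat_def)
  have "fn_mat vs d * fn_mat vs (\<lambda>x. inverse (d x)) = 1\<^sub>m (length vs)"
    "fn_mat vs (\<lambda>x. inverse (d x)) * fn_mat vs d = 1\<^sub>m (length vs)"
    using nz by (auto intro: inv)
  moreover have "dim_row (fn_mat vs f) = length vs" "dim_col (fn_mat vs f) = length vs" for f
    using fn_mat_carrier by auto
  ultimately show "invertible_mat (fn_mat vs d)"
    unfolding invertible_mat_def inverts_mat_def square_mat.simps by metis
qed

text \<open>The index lists with a nonzero entry are exactly the orderings of the edges. The first
  position supplies the distinguished vertex \<open>x\<close>, and every vertex of an edge can be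
  put there.\<close>

lemma adjacency_equation_iff:
  fixes d :: "'a \<Rightarrow> complex"
  assumes u: "uniform_hypergraph m H" and vs: "vertex_enum vs H" and m: "m \<ge> 1"
    and nz: "\<And>x. x \<in> verts H \<Longrightarrow> d x \<noteq> 0"
  shows "(\<forall>idx. length idx = m \<and> set idx \<subseteq> {..<length vs} \<longrightarrow>
       inverse (d (vs ! (idx ! 0))) ^ (m - 1) * adjacency_tensor m H vs idx *
         (\<Prod>k=1..<m. d (vs ! (idx ! k))) = adjacency_tensor m H vs idx) \<longleftrightarrow>
     (\<forall>e\<in>edges H. \<forall>x\<in>e. d x ^ m = (\<Prod>y\<in>e. d y))" (is "(\<forall>idx. ?I idx \<longrightarrow> ?P idx) \<longleftrightarrow> ?R")
proof -
  have key: "?P idx \<longleftrightarrow> d (vs ! (idx ! 0)) ^ m = (\<Prod>y\<in>(!) vs ` set idx. d y)"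
    if idx: "?I idx" and e: "(!) vs ` set idx \<in> edges H" for idx
  proof -
    define ys where "ys = map ((!) vs) idx"
    have len: "length ys = m" and st: "set ys = (!) vs ` set idx" using idx by (auto simp: ys_def)
    \<comment> \<open>A list of \<open>m\<close> vertices whose set is an edge with \<open>m\<close>
      elements has no repetition, so its product is the product over the edge.\<close>
    have "card (set ys) = length ys" using uniform_edge(2)[OF u] e st len by simp
    then have dist: "distinct ys" by (rule card_distinct)
    define P where "P = (\<Prod>k=1..<m. d (ys ! k))"
    have Peq: "(\<Prod>k=1..<m. d (vs ! (idx ! k))) = P"
      unfolding P_def using idx by (intro prod.cong) (auto simp: ys_def)
    have y0: "vs ! (idx ! 0) = ys ! 0" using idx m by (simp add: ys_def)
    have A: "adjacency_tensor m H vs idx = 1 / fact (m - 1)"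
      using e by (simp add: adjacency_tensor_def)
    have prod: "(\<Prod>y\<in>set ys. d y) = d (ys ! 0) * P"
    proof -
      have "(\<Prod>y\<in>set ys. d y) = (\<Prod>k<m. d (ys ! k))"
        using prod.reindex_bij_betw[OF bij_betw_nth[OF dist, of "{..<m}" "set ys"]] len
        by (metis lessThan_iff)
      also have "\<dots> = d (ys ! 0) * P"
        using m by (simp add: P_def lessThan_atLeast0 prod.atLeast_Suc_lessThan)
      finally show ?thesis .
    qed
    have "ys ! 0 \<in> verts H"
      using uniform_edge(1)[OF u e] st len m nth_mem[of 0 ys] by auto
    then have n0: "d (ys ! 0) \<noteq> 0" by (rule nz)
    have pw: "d (ys ! 0) ^ m = d (ys ! 0) * d (ys ! 0) ^ (m - 1)"
      using m by (cases m) auto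
    \<comment> \<open>The nonzero factor \<open>1 / fact (m - 1)\<close> cancels, and multiplying by
      \<open>d (ys ! 0) ^ m\<close> yields the edge equation.\<close>
    have "?P idx \<longleftrightarrow> inverse (d (ys ! 0)) ^ (m - 1) * P = 1"
      unfolding Peq y0 A by simp
    also have "\<dots> \<longleftrightarrow> P = d (ys ! 0) ^ (m - 1)"
      using n0 by (simp add: power_inverse field_simps)
    also have "\<dots> \<longleftrightarrow> d (ys ! 0) ^ m = (\<Prod>y\<in>set ys. d y)"
      using n0 by (auto simp: pw prod)
    finally show ?thesis by (simp only: st y0)
  qed
  have vs': "distinct vs" "set vs = verts H" using vs by (auto simp: vertex_enum_def)
  show ?thesis
  proof (intro iffI ballI allI impI)
    fix e x assume L: "\<forall>idx. ?I idx \<longrightarrow> ?P idx" and e: "e \<in> edges H" and x: "x \<in> e"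
    have fin: "finite e"
      using uniform_edge(1)[OF u e] u by (auto simp: uniform_hypergraph_def intro: finite_subset)
    \<comment> \<open>The index list witnessing the equation at \<open>x\<close> enumerates
      \<open>e\<close> with \<open>x\<close> in front.\<close>
    obtain zs where zs: "set zs = e - {x}" "distinct zs"
      using finite_distinct_list[of "e - {x}"] fin by auto
    define pos where "pos = inv_into {..<length vs} ((!) vs)"
    have V: "(!) vs ` {..<length vs} = verts H"
      using vs'(2) by (auto simp: set_conv_nth)
    have pos: "pos y < length vs" "vs ! pos y = y" if "y \<in> e" for y
    proof -
      have "y \<in> (!) vs ` {..<length vs}" using that V uniform_edge(1)[OF u e] by blast
      then show "pos y < length vs" "vs ! pos y = y"
        unfolding pos_def using inv_into_into f_inv_into_f by (metis lessThan_iff)+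
    qed
    define idx where "idx = map pos (x # zs)"
    have st: "set (x # zs) = e" using zs x by auto
    have "distinct (x # zs)" using zs by simp
    from distinct_card[OF this] have "length (x # zs) = card e" using st by simp
    then have len: "length idx = m" using uniform_edge(2)[OF u e] by (simp add: idx_def)
    have "set idx = pos ` e" unfolding st[symmetric] by (simp add: idx_def)
    then have im: "(!) vs ` set idx = e" and sb: "set idx \<subseteq> {..<length vs}"
      using pos by (force simp: image_image)+
    have "vs ! (idx ! 0) = x" using pos x by (simp add: idx_def)
    then show "d x ^ m = (\<Prod>y\<in>e. d y)" using key[of idx] L im len sb e by auto
  next
    fix idx assume R: ?R and idx: "?I idx"
    show "?P idx"
    proof (cases "(!) vs ` set idx \<in> edges H")
      case True
      have "idx ! 0 \<in> set idx" using idx m by simp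
      then show ?thesis using key[OF idx True] R True by blast
    next
      case False
      then show ?thesis by (simp add: adjacency_tensor_def)
    qed
  qed
qed

text \<open>\<open>fn_mat vs\<close> is a bijection from the solutions normalized at the first
  listed vertex onto the stabilizer, since \<open>D $$ (0, 0) = 1\<close> is that normalization. As
  \<open>stab_number\<close> is independent of the base vertex, the enumeration does not affect the
  index.\<close>

lemma stab_index_eq:
  assumes u: "uniform_hypergraph m H" and vs: "vertex_enum vs H" and m: "m \<ge> 1"
  shows "stab_index m H vs = stab_number m H"
proof -
  let ?n = "length vs" and ?A = "adjacency_tensor m H vs"
  have vs': "distinct vs" "set vs = verts H" using vs by (auto simp: vertex_enum_def)
  have n: "?n > 0" using u vs' by (auto simp: uniform_hypergraph_def)
  have r: "vs ! 0 \<in> verts H" using n vs' nth_mem by blast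
  have iff: "fn_mat vs d \<in> stabilizer m ?n ?A \<longleftrightarrow> d \<in> stab_fns m H (vs ! 0)"
    if ext: "d \<in> extensional (verts H)" for d
  proof -
    have ent: "fn_mat vs d $$ (i, i) = d (vs ! i)" if "i < ?n" for i
      using that by (simp add: fn_mat_def)
    have diag: "diagonal_mat (fn_mat vs d)"
      by (simp add: diagonal_mat_def fn_mat_def)
    have eq: "inverse (fn_mat vs d $$ (idx ! 0, idx ! 0)) ^ (m - 1) * ?A idx *
            (\<Prod>k=1..<m. fn_mat vs d $$ (idx ! k, idx ! k)) =
          inverse (d (vs ! (idx ! 0))) ^ (m - 1) * ?A idx * (\<Prod>k=1..<m. d (vs ! (idx ! k)))"
      if "length idx = m" "set idx \<subseteq> {..<?n}" for idx
    proof -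
      have lt: "idx ! k < ?n" if "k < m" for k
        using that \<open>length idx = m\<close> \<open>set idx \<subseteq> {..<?n}\<close> nth_mem by blast
      have "(\<Prod>k=1..<m. fn_mat vs d $$ (idx ! k, idx ! k)) = (\<Prod>k=1..<m. d (vs ! (idx ! k)))"
        using lt ent by (intro prod.cong) auto
      then show ?thesis using ent lt m by simp
    qed
    have "(\<forall>idx. length idx = m \<and> set idx \<subseteq> {..<?n} \<longrightarrow>
        inverse (fn_mat vs d $$ (idx ! 0, idx ! 0)) ^ (m - 1) * ?A idx *
          (\<Prod>k=1..<m. fn_mat vs d $$ (idx ! k, idx ! k)) = ?A idx) \<longleftrightarrow>
      (\<forall>idx. length idx = m \<and> set idx \<subseteq> {..<?n} \<longrightarrow>
        inverse (d (vs ! (idx ! 0))) ^ (m - 1) * ?A idx *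
          (\<Prod>k=1..<m. d (vs ! (idx ! k))) = ?A idx)"
      by (intro all_cong1 imp_cong refl) (simp only: eq)
    then have "fn_mat vs d \<in> stabilizer m ?n ?A \<longleftrightarrow>
      (\<forall>x\<in>verts H. d x \<noteq> 0) \<and> d (vs ! 0) = 1 \<and>
      (\<forall>idx. length idx = m \<and> set idx \<subseteq> {..<?n} \<longrightarrow>
       inverse (d (vs ! (idx ! 0))) ^ (m - 1) * ?A idx *
         (\<Prod>k=1..<m. d (vs ! (idx ! k))) = ?A idx)"
      unfolding stabilizer_def using invertible_fn_mat[of vs d] vs'(2) ent[OF n]
        fn_mat_carrier[of vs d] diag by simp
    then show ?thesis
      using adjacency_equation_iff[OF u vs m, of d] ext unfolding stab_fns_def by blast
  qed
  have "bij_betw (fn_mat vs) (stab_fns m H (vs ! 0)) (stabilizer m ?n ?A)"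
    unfolding bij_betw_def
  proof
    show "inj_on (fn_mat vs) (stab_fns m H (vs ! 0))"
    proof (rule inj_onI)
      fix a b assume ab: "a \<in> stab_fns m H (vs ! 0)" "b \<in> stab_fns m H (vs ! 0)"
        and eq: "fn_mat vs a = fn_mat vs b"
      have "a x = b x" if x: "x \<in> verts H" for x
      proof -
        obtain i where "i < ?n" "vs ! i = x" using x vs' by (metis in_set_conv_nth)
        moreover have "fn_mat vs a $$ (i, i) = fn_mat vs b $$ (i, i)" using eq by simp
        ultimately show ?thesis by (simp add: fn_mat_def)
      qed
      then show "a = b" using ab by (auto simp: stab_fns_def intro: extensionalityI)
    qed
    show "fn_mat vs ` stab_fns m H (vs ! 0) = stabilizer m ?n ?A"
    proof (intro equalityI subsetI)
      fix D assume "D \<in> fn_mat vs ` stab_fns m H (vs ! 0)"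
      then show "D \<in> stabilizer m ?n ?A" using iff by (auto simp: stab_fns_def)
    next
      fix D assume D: "D \<in> stabilizer m ?n ?A"
      \<comment> \<open>The preimage of \<open>D\<close> is read off its diagonal, with each vertex
        sent to its position in \<open>vs\<close>.\<close>
      define pos where "pos = the_inv_into {..<?n} ((!) vs)"
      define d where "d = restrict (\<lambda>x. D $$ (pos x, pos x)) (verts H)"
      have "inj_on ((!) vs) {..<?n}" using vs' by (simp add: inj_on_nth)
      then have "pos (vs ! i) = i" if "i < ?n" for i
        using that by (simp add: pos_def the_inv_into_f_f)
      then have "d (vs ! i) = D $$ (i, i)" if "i < ?n" for i
        using that vs' nth_mem by (fastforce simp: d_def)
      then have "D = fn_mat vs d"
        using D by (intro eq_matI) (auto simp: stabilizer_def fn_mat_def diagonal_mat_def)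
      moreover have "d \<in> extensional (verts H)" by (simp add: d_def)
      ultimately show "D \<in> fn_mat vs ` stab_fns m H (vs ! 0)" using D iff by blast
    qed
  qed
  then have "card (stab_fns m H (vs ! 0)) = card (stabilizer m ?n ?A)"
    by (rule bij_betw_same_card)
  then show ?thesis
    using stab_number_eq[OF u r] by (simp add: stab_index_def tensor_stab_index_def)
qed

theorem theorem3p2:
  fixes m s :: nat
    and G :: "'a hypergraph"
    and vs :: "'a list"
    and Gs :: "nat \<Rightarrow> 'a hypergraph"
    and ws :: "nat \<Rightarrow> 'a list"
  assumes "m \<ge> 2"
    and "uniform_hypergraph m G"
    and "hconnected G"
    and "\<exists>u. cut_vertex m G u"
    and "s \<ge> 2"
    and "bij_betw Gs {1..s} {B. block m B G}"
    and "vertex_enum vs G"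
    and "\<And>i. i \<in> {1..s} \<Longrightarrow> vertex_enum (ws i) (Gs i)"
  shows "stab_index m G vs = (\<Prod>i=1..s. stab_index m (Gs i) (ws i))"
proof -
  \<comment> \<open>The split at a cut vertex provides an edge, hence the nontriviality that
    \<open>stab_number_blocks\<close> asks for.\<close>
  obtain u G1 G2 where sp: "split_at m G u G1 G2"
    using assms(4) cut_vertex_split[OF assms(2)] by blast
  have "edges G \<noteq> {}"
    using split_edges_nonempty[OF sp] sp by (auto simp: split_at_def)
  then have nt: "nontrivial G" using edges_nontrivial assms(1,2) by blast
  have "stab_index m (Gs i) (ws i) = stab_number m (Gs i)" if i: "i \<in> {1..s}" for i
  proof -
    have "block m (Gs i) G" using assms(6) i by (auto simp: bij_betw_def)
    then have "uniform_hypergraph m (Gs i)"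
      by (simp add: block_def conn_sub_without_cut_def sub_hypergraph_def)
    then show ?thesis using stab_index_eq assms(1,8) i by (metis one_le_numeral order_trans)
  qed
  then have "(\<Prod>i=1..s. stab_index m (Gs i) (ws i)) = (\<Prod>i=1..s. stab_number m (Gs i))"
    by (intro prod.cong) auto
  \<comment> \<open>The blocks are numbered without repetition, so the product over indices is one
    over the set of blocks.\<close>
  also have "\<dots> = (\<Prod>B | block m B G. stab_number m B)"
    by (rule prod.reindex_bij_betw[OF assms(6)])
  also have "\<dots> = stab_number m G"
    using stab_number_blocks[OF assms(2,3) nt assms(1)] by simp
  also have "\<dots> = stab_index m G vs"
    using stab_index_eq[OF assms(2,7)] assms(1) by simp
  finally show ?thesis by simp
qed

end
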